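(* Let $E$ be a finite set, $r:2^E\to\mathbb{Z}$ any function, and $m_1,m_2:2^E\to R$ ($R$ a commutative ring with $1$), with pointwise product $m_1m_2$. Let $a,b,c,d$ be indeterminates. Then $$T_{(E,r,m_1m_2)}(1-ab,1-cd)=\sum_{A\subseteq E}a^{r(E)-r(A)}d^{|A|-r(A)}\,T_{(E,r,m_1)|A}(1-a,1-c)\,T_{(E,r,m_2)/A}(1-b,1-d).$$
   Context: For a ranked set with multiplicity $\mathcal{N}=(E',r',m')$ ($E'$ finite, $r':2^{E'}\to\mathbb{Z}$, $m':2^{E'}\to R$ arbitrary), its Tutte polynomial is $T_{\mathcal{N}}(x,y)=\sum_{A\subseteq E'}m'(A)(x-1)^{r'(E')-r'(A)}(y-1)^{|A|-r'(A)}$ (a Laurent polynomial in $x-1,y-1$). For $\mathcal{M}=(E,r,m)$ and $A\subseteq E$: restriction $\mathcal{M}|A=(A,r|_{2^A},m|_{2^A})$; contraction $\mathcal{M}/A=(E\setminus A,r'',m'')$ with $r''(B)=r(B\cup A)-r(A)$, $m''(B)=m(B\cup A)$. *)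

theory Defs
  imports "HOL-Library.Poly_Mapping" "HOL-Library.FuncSet"
begin

text \<open>
  Laurent polynomials over \<open>'r\<close> in indeterminates indexed by \<open>'v\<close>: finitely supported
  families of coefficients, indexed by finitely supported integer exponent vectors, with the
  convolution product.
\<close>

type_synonym ('v, 'r) laurent = "('v \<Rightarrow>\<^sub>0 int) \<Rightarrow>\<^sub>0 'r"

definition laurent_const :: "'r::comm_ring_1 \<Rightarrow> ('v, 'r) laurent" where
  "laurent_const c = Poly_Mapping.single 0 c"

definition laurent_var :: "'v \<Rightarrow> ('v, 'r::comm_ring_1) laurent" where
  "laurent_var v = Poly_Mapping.single (Poly_Mapping.single v 1) 1"

text \<open>
  Integer powers of the units of a commutative ring; the library's \<^const>\<open>power_int\<close> needs a
  division operation. The value at a negative exponent is meaningful only if the base is a unit.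
\<close>

definition unit_inverse :: "'a::comm_ring_1 \<Rightarrow> 'a" where
  "unit_inverse u = (THE w. u * w = 1)"

definition unit_power_int :: "'a::comm_ring_1 \<Rightarrow> int \<Rightarrow> 'a" (infixr \<open>upowi\<close> 80) where
  "u upowi k = (if k \<ge> 0 then u ^ nat k else unit_inverse u ^ nat (- k))"

text \<open>
  Substitution of \<open>\<sigma> v\<close> for each indeterminate \<open>v\<close>; a homomorphism of \<open>'r\<close>-algebras
  provided every \<open>\<sigma> v\<close> is a unit.
\<close>

definition laurent_subst ::
    "('v \<Rightarrow> ('w, 'r) laurent) \<Rightarrow> ('v, 'r::comm_ring_1) laurent \<Rightarrow> ('w, 'r) laurent" where
  "laurent_subst \<sigma> p =
     (\<Sum>k\<in>Poly_Mapping.keys p.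
        laurent_const (Poly_Mapping.lookup p k) *
        (\<Prod>v\<in>Poly_Mapping.keys k. \<sigma> v upowi Poly_Mapping.lookup k v))"

text \<open>
  Ranked sets with multiplicity. Only the values of \<open>rank\<close> and \<open>mult\<close> on subsets of
  \<open>ground\<close> are significant.
\<close>

record ('e, 'r) ranked_set_mult =
  ground :: "'e set"
  rank :: "'e set \<Rightarrow> int"
  mult :: "'e set \<Rightarrow> 'r"

definition rsm :: "'e set \<Rightarrow> ('e set \<Rightarrow> int) \<Rightarrow> ('e set \<Rightarrow> 'r) \<Rightarrow> ('e, 'r) ranked_set_mult" where
  "rsm E r m = \<lparr>ground = E, rank = r, mult = m\<rparr>"

definition rsm_restrict ::
    "('e, 'r) ranked_set_mult \<Rightarrow> 'e set \<Rightarrow> ('e, 'r) ranked_set_mult" where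
  "rsm_restrict M A = rsm A (restrict (rank M) (Pow A)) (restrict (mult M) (Pow A))"

definition rsm_contract ::
    "('e, 'r) ranked_set_mult \<Rightarrow> 'e set \<Rightarrow> ('e, 'r) ranked_set_mult" where
  "rsm_contract M A =
     rsm (ground M - A)
       (\<lambda>B\<in>Pow (ground M - A). rank M (B \<union> A) - rank M A)
       (\<lambda>B\<in>Pow (ground M - A). mult M (B \<union> A))"

text \<open>
  The Tutte polynomial is a Laurent polynomial in \<open>x - 1\<close> and \<open>y - 1\<close>, so these two are taken
  as the indeterminates, and evaluation at \<open>(x, y)\<close> substitutes \<open>x - 1\<close> and \<open>y - 1\<close> for them.
\<close>

datatype tutte_var = X_minus_1 | Y_minus_1

definition tutte_poly ::
    "('e, 'r::comm_ring_1) ranked_set_mult \<Rightarrow> (tutte_var, 'r) laurent" where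
  "tutte_poly N =
     (\<Sum>A\<in>Pow (ground N).
        laurent_const (mult N A)
        * laurent_var X_minus_1 upowi (rank N (ground N) - rank N A)
        * laurent_var Y_minus_1 upowi (int (card A) - rank N A))"

definition tutte_eval ::
    "('e, 'r::comm_ring_1) ranked_set_mult
      \<Rightarrow> ('w, 'r) laurent \<Rightarrow> ('w, 'r) laurent \<Rightarrow> ('w, 'r) laurent" where
  "tutte_eval N x y =
     laurent_subst (case_tutte_var (x - 1) (y - 1)) (tutte_poly N)"

datatype indet = Ind_a | Ind_b | Ind_c | Ind_d

end

theory Submission
  imports Defs
begin

text \<open>
  Write the right-hand side as a sum over chains \<open>B \<subseteq> A \<subseteq> D \<subseteq> E\<close>, where \<open>B\<close> indexes the Tutte
  polynomial of the restriction to \<open>A\<close>, and \<open>D - A\<close> that of the contraction by \<open>A\<close>. All powers of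
  the indeterminates telescope to exponents depending on \<open>B\<close> and \<open>D\<close> only, and \<open>A\<close> survives just
  in the sign \<open>(-1)\<^bsup>|A|\<^esup>\<close>. Its sum over the interval from \<open>B\<close> to \<open>D\<close> vanishes unless \<open>B = D\<close>, and
  the diagonal terms are those of the left-hand side.
\<close>

section \<open>Integer powers of units\<close>

lemma unit_inverse_eqI:
  fixes u :: "'a::comm_ring_1"
  assumes "u * w = 1"
  shows "unit_inverse u = w"
  unfolding unit_inverse_def
proof (rule the_equality)
  fix v assume "u * v = 1"
  then have "w = w * (u * v)" by simp
  also have "\<dots> = (u * w) * v" by (simp add: ac_simps)
  finally show "v = w" using assms by simp
qed (fact assms)

text \<open>Surplus factors cancel in pairs \<open>u * w = 1\<close>, so \<open>p\<close> and
  \<open>q\<close> may be arbitrary. Every integer is such a difference, so the laws of integer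
  exponents follow from those of natural ones without a case distinction on signs.\<close>

lemma upowi_diff_of_nat:
  fixes u :: "'a::comm_ring_1"
  assumes "u * w = 1"
  shows "u upowi (int p - int q) = u ^ p * w ^ q"
proof (cases "q \<le> p")
  case True
  then obtain n where n: "p = q + n" using le_Suc_ex by blast
  have "u ^ p * w ^ q = u ^ n * (u * w) ^ q"
    by (simp add: n power_add power_mult_distrib ac_simps)
  then show ?thesis by (simp add: assms n unit_power_int_def)
next
  case False
  then obtain n where n: "q = p + n" using le_Suc_ex by (metis nat_le_linear)
  have "u ^ p * w ^ q = w ^ n * (u * w) ^ p"
    by (simp add: n power_add power_mult_distrib ac_simps)
  with False show ?thesis
    by (simp add: assms n unit_power_int_def unit_inverse_eqI[OF assms])
qed

lemma upowi_0 [simp]: "u upowi 0 = 1"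
  by (simp add: unit_power_int_def)

lemma upowi_of_nat [simp]: "u upowi int n = u ^ n"
  by (simp add: unit_power_int_def)

lemma upowi_add:
  assumes "u dvd 1"
  shows "u upowi (i + j) = u upowi i * u upowi j"
proof -
  from assms obtain w where w: "u * w = 1" by (metis dvdE)
  obtain p q p' q' where ij: "i = int p - int q" "j = int p' - int q'"
    by (metis int_diff_cases)
  then have "i + j = int (p + p') - int (q + q')" by simp
  then show ?thesis
    by (simp only: ij upowi_diff_of_nat[OF w] power_add ac_simps)
qed

lemma upowi_mult_distrib:
  assumes "u dvd 1" "v dvd 1"
  shows "(u * v) upowi k = u upowi k * v upowi k"
proof -
  from assms obtain w z where w: "u * w = 1" and z: "v * z = 1" by (metis dvdE)
  have wz: "(u * v) * (w * z) = 1"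
    using w z by (metis mult.assoc mult.left_commute mult_1_right)
  obtain p q where k: "k = int p - int q" by (metis int_diff_cases)
  show ?thesis
    by (simp only: k upowi_diff_of_nat[OF w] upowi_diff_of_nat[OF z] upowi_diff_of_nat[OF wz]
        power_mult_distrib ac_simps)
qed

lemma upowi_uminus:
  assumes "u dvd 1"
  shows "(- u) upowi k = (-1) upowi k * u upowi k"
  using upowi_mult_distrib[of "-1" u k] assms by simp

lemma minus_one_upowi_double: "(-1 :: 'a::comm_ring_1) upowi (2 * k) = 1"
proof -
  have "(-1 :: 'a) upowi (2 * k) = ((-1) * (-1)) upowi k"
    by (simp only: mult_2 upowi_add upowi_mult_distrib minus_dvd_iff dvd_refl)
  then show ?thesis by (cases "k \<ge> 0") (simp_all add: unit_power_int_def unit_inverse_eqI[of 1 1])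
qed

text \<open>Ranks are arbitrary integers, so sign exponents may be negative; this lets them be
  compared by parity alone.\<close>

lemma minus_one_upowi_cong:
  assumes "even (i - j)"
  shows "(-1 :: 'a::comm_ring_1) upowi i = (-1) upowi j"
proof -
  from assms obtain k where "i = j + 2 * k" by (metis evenE add.commute diff_add_cancel)
  then show ?thesis by (simp add: upowi_add[of _ j] minus_one_upowi_double)
qed

section \<open>Laurent monomials and substitution\<close>

lemma laurent_const_mult: "laurent_const (x * y) = laurent_const x * laurent_const y"
  by (simp add: laurent_const_def mult_single)

lemma laurent_var_mult_inverse:
  "laurent_var v * Poly_Mapping.single (Poly_Mapping.single v (-1)) 1 = 1"
  by (simp add: laurent_var_def mult_single flip: single_add)

lemma laurent_var_dvd_1: "laurent_var v dvd 1"
  by (metis dvdI laurent_var_mult_inverse)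

lemma single_var_power:
  "Poly_Mapping.single (Poly_Mapping.single v k) (1::'r::comm_ring_1) ^ n =
    Poly_Mapping.single (Poly_Mapping.single v (int n * k)) 1"
  by (induction n) (simp_all add: mult_single algebra_simps flip: single_add)

lemma laurent_var_upowi:
  "laurent_var v upowi k = Poly_Mapping.single (Poly_Mapping.single v k) (1::'r::comm_ring_1)"
proof -
  obtain p q where k: "k = int p - int q" by (metis int_diff_cases)
  show ?thesis
    unfolding k upowi_diff_of_nat[OF laurent_var_mult_inverse]
    by (simp add: laurent_var_def single_var_power mult_single flip: single_add)
qed

text \<open>Exponent vectors outside the support have coefficient 0. A common index set for
  \<open>p\<close>, \<open>q\<close> and \<open>p + q\<close> makes additivity a termwise matter
  even when coefficients cancel.\<close>

lemma laurent_subst_superset: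
  assumes "finite K" "Poly_Mapping.keys p \<subseteq> K"
  shows "laurent_subst \<sigma> p =
    (\<Sum>k\<in>K. laurent_const (Poly_Mapping.lookup p k) *
      (\<Prod>v\<in>Poly_Mapping.keys k. \<sigma> v upowi Poly_Mapping.lookup k v))"
  unfolding laurent_subst_def
  by (rule sum.mono_neutral_left) (use assms in \<open>auto simp: laurent_const_def in_keys_iff\<close>)

lemma laurent_subst_0: "laurent_subst \<sigma> 0 = 0"
  by (simp add: laurent_subst_def)

lemma laurent_subst_add: "laurent_subst \<sigma> (p + q) = laurent_subst \<sigma> p + laurent_subst \<sigma> q"
proof -
  let ?K = "Poly_Mapping.keys p \<union> Poly_Mapping.keys q"
  have "Poly_Mapping.keys (p + q) \<subseteq> ?K" by (rule keys_add)
  then show ?thesis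
    by (simp add: laurent_subst_superset[of ?K] lookup_add laurent_const_def single_add
        distrib_right sum.distrib)
qed

lemma laurent_subst_sum: "laurent_subst \<sigma> (sum f I) = (\<Sum>i\<in>I. laurent_subst \<sigma> (f i))"
  by (induction I rule: infinite_finite_induct) (simp_all add: laurent_subst_0 laurent_subst_add)

text \<open>Together with additivity this evaluates any Tutte polynomial, without multiplicativity
  of the substitution.\<close>

lemma laurent_subst_tutte_monomial:
  "laurent_subst \<sigma>
     (laurent_const t * laurent_var X_minus_1 upowi i * laurent_var Y_minus_1 upowi j) =
   laurent_const t * \<sigma> X_minus_1 upowi i * \<sigma> Y_minus_1 upowi j"
proof -
  let ?k = "Poly_Mapping.single X_minus_1 i + Poly_Mapping.single Y_minus_1 j"
  have eq: "laurent_const t * laurent_var X_minus_1 upowi i * laurent_var Y_minus_1 upowi j =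
    Poly_Mapping.single ?k t"
    by (simp add: laurent_var_upowi laurent_const_def mult_single)
  \<comment> \<open>A variable with exponent 0 is missing from the keys, but its factor would be
    \<open>upowi 0\<close>, that is 1.\<close>
  have "(\<Prod>v\<in>Poly_Mapping.keys ?k. \<sigma> v upowi Poly_Mapping.lookup ?k v) =
    (\<Prod>v\<in>{X_minus_1, Y_minus_1}. \<sigma> v upowi Poly_Mapping.lookup ?k v)"
    by (rule prod.mono_neutral_left) (auto simp: in_keys_iff intro: tutte_var.exhaust)
  also have "\<dots> = \<sigma> X_minus_1 upowi i * \<sigma> Y_minus_1 upowi j"
    by (simp add: lookup_add lookup_single)
  \<comment> \<open>For \<open>t = 0\<close> the support is empty, so \<open>{?k}\<close> is in
    general only a superset of it.\<close>
  finally show ?thesis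
    unfolding eq by (simp add: laurent_subst_superset[of "{?k}"] mult.assoc)
qed

section \<open>Tutte evaluations as sums over subsets\<close>

lemma tutte_eval_eq_sum:
  "tutte_eval N x y =
    (\<Sum>A\<in>Pow (ground N). laurent_const (mult N A)
      * (x - 1) upowi (rank N (ground N) - rank N A)
      * (y - 1) upowi (int (card A) - rank N A))"
  by (simp add: tutte_eval_def tutte_poly_def laurent_subst_sum laurent_subst_tutte_monomial)

lemma tutte_eval_restrict:
  "tutte_eval (rsm_restrict (rsm E r m) A) x y =
    (\<Sum>B\<in>Pow A. laurent_const (m B) * (x - 1) upowi (r A - r B)
      * (y - 1) upowi (int (card B) - r B))"
  by (simp add: tutte_eval_eq_sum rsm_restrict_def rsm_def)

text \<open>Reindexing by \<open>D = C \<union> A\<close> turns subsets of the contracted ground set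
  into the upper ends of the chains.\<close>

lemma tutte_eval_contract:
  assumes "finite E" "A \<subseteq> E"
  shows "tutte_eval (rsm_contract (rsm E r m) A) x y =
    (\<Sum>D\<in>{A..E}. laurent_const (m D) * (x - 1) upowi (r E - r D)
      * (y - 1) upowi (int (card D) - int (card A) - r D + r A))"
proof -
  have E: "E \<union> A = E" using assms by auto
  have "tutte_eval (rsm_contract (rsm E r m) A) x y =
    (\<Sum>C\<in>Pow (E - A). laurent_const (m (C \<union> A)) * (x - 1) upowi (r E - r (C \<union> A))
      * (y - 1) upowi (int (card C) - r (C \<union> A) + r A))"
    by (simp add: tutte_eval_eq_sum rsm_contract_def rsm_def E algebra_simps)
  also have "\<dots> = (\<Sum>D\<in>{A..E}. laurent_const (m D) * (x - 1) upowi (r E - r D)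
      * (y - 1) upowi (int (card D) - int (card A) - r D + r A))"
  proof (rule sum.reindex_bij_witness[of _ "\<lambda>D. D - A" "\<lambda>C. C \<union> A"])
    fix C assume "C \<in> Pow (E - A)"
    then have "card (C \<union> A) = card C + card A"
      using assms by (intro card_Un_disjoint) (auto intro: finite_subset)
    then show "laurent_const (m (C \<union> A)) * (x - 1) upowi (r E - r (C \<union> A))
        * (y - 1) upowi (int (card (C \<union> A)) - int (card A) - r (C \<union> A) + r A) =
      laurent_const (m (C \<union> A)) * (x - 1) upowi (r E - r (C \<union> A))
        * (y - 1) upowi (int (card C) - r (C \<union> A) + r A)"
      by simp
  qed (use assms in auto)
  finally show ?thesis .
qed

section \<open>Alternating sums and chains of subsets\<close>

lemma sum_minus_one_card_interval:
  assumes "finite D"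
  shows "(\<Sum>A\<in>{B..D}. (-1 :: 'a::comm_ring_1) ^ card A) = (if B = D then (-1) ^ card D else 0)"
proof (cases "B \<subset> D")
  case True
  have "{B..D} \<subseteq> Pow D" by auto
  then have fin: "finite {B..D}" using assms by (simp add: finite_subset)
  \<comment> \<open>Toggling an element of \<open>D - B\<close> pairs the even sets of the interval
    with the odd ones.\<close>
  have "card {A \<in> {B..D}. even (card A)} = card {A \<in> {B..D}. odd (card A)}"
    using card_subsupersets_even_odd[OF assms True] by (simp add: conj_ac)
  with True show ?thesis by (simp add: sum_alternating_cancels[OF fin])
next
  case False
  then show ?thesis by (cases "B = D") auto
qed

text \<open>The middle set becomes innermost by two exchanges, first with \<open>B\<close>, then
  with \<open>D\<close>. Both ends can range over all of \<open>Pow E\<close>, since the interval is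
  empty unless \<open>B \<subseteq> D\<close>.\<close>

lemma sum_Pow_chains:
  assumes "finite E"
  shows "(\<Sum>A\<in>Pow E. \<Sum>B\<in>Pow A. \<Sum>D\<in>{A..E}. f A B D) =
    (\<Sum>B\<in>Pow E. \<Sum>D\<in>Pow E. \<Sum>A\<in>{B..D}. f A B D)"
proof -
  have fin: "finite (Pow E)" using assms by simp
  have "(\<Sum>A\<in>Pow E. \<Sum>B\<in>Pow A. \<Sum>D\<in>{A..E}. f A B D) =
    (\<Sum>A\<in>Pow E. \<Sum>B\<in>{B \<in> Pow E. B \<subseteq> A}. \<Sum>D\<in>{D \<in> Pow E. A \<subseteq> D}. f A B D)"
    by (intro sum.cong) auto
  also have "\<dots> = (\<Sum>B\<in>Pow E. \<Sum>A\<in>{A \<in> Pow E. B \<subseteq> A}. \<Sum>D\<in>{D \<in> Pow E. A \<subseteq> D}. f A B D)"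
    using fin fin by (rule sum.swap_restrict)
  also have "\<dots> = (\<Sum>B\<in>Pow E. \<Sum>D\<in>Pow E. \<Sum>A\<in>{A \<in> {A \<in> Pow E. B \<subseteq> A}. A \<subseteq> D}. f A B D)"
    by (intro sum.cong refl sum.swap_restrict) (use fin in auto)
  also have "\<dots> = (\<Sum>B\<in>Pow E. \<Sum>D\<in>Pow E. \<Sum>A\<in>{B..D}. f A B D)"
    by (intro sum.cong refl) (simp add: set_eq_iff[of "Collect _"], blast)
  finally show ?thesis .
qed

theorem theorem3p13:
  fixes E :: "'e set"
    and r :: "'e set \<Rightarrow> int"
    and m1 m2 :: "'e set \<Rightarrow> 'r::comm_ring_1"
    and a b c d :: "(indet, 'r) laurent"
  assumes "finite E"
    and "a = laurent_var Ind_a" and "b = laurent_var Ind_b"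
    and "c = laurent_var Ind_c" and "d = laurent_var Ind_d"
  shows "tutte_eval (rsm E r (\<lambda>A. m1 A * m2 A)) (1 - a * b) (1 - c * d) =
    (\<Sum>A\<in>Pow E.
       a upowi (r E - r A) * d upowi (int (card A) - r A)
       * tutte_eval (rsm_restrict (rsm E r m1) A) (1 - a) (1 - c)
       * tutte_eval (rsm_contract (rsm E r m2) A) (1 - b) (1 - d))"
proof -
  have units: "a dvd 1" "b dvd 1" "c dvd 1" "d dvd 1"
    using assms by (simp_all add: laurent_var_dvd_1)
  \<comment> \<open>This collects what is independent of \<open>A\<close>. The signs of
    \<open>a\<close> and \<open>d\<close> are split off into the last factor; \<open>- b\<close> and
    \<open>- c\<close> keep theirs, so that on the diagonal \<open>a * (- b)\<close> and
    \<open>(- c) * d\<close> give the bases of the left-hand side.\<close>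
  define F where "F B D = laurent_const (m1 B * m2 D) * a upowi (r E - r B)
      * (- b) upowi (r E - r D) * (- c) upowi (int (card B) - r B)
      * d upowi (int (card D) - r D) * (-1) upowi (int (card D) - r B - r D)" for B D
  \<comment> \<open>The negated bases arise from evaluation at \<open>1 - a\<close> and the like, as
    \<open>(1 - a) - 1 = - a\<close>.\<close>
  have telescope: "a upowi (r E - r A) * d upowi (int (card A) - r A)
      * (laurent_const (m1 B) * (- a) upowi (r A - r B) * (- c) upowi (int (card B) - r B))
      * (laurent_const (m2 D) * (- b) upowi (r E - r D)
          * (- d) upowi (int (card D) - int (card A) - r D + r A)) =
    F B D * (-1) ^ card A" for A B D
  proof -
    let ?j = "int (card D) - int (card A) - r D + r A"
    have a: "a upowi (r E - r A) * (- a) upowi (r A - r B) =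
        (-1) upowi (r A - r B) * a upowi (r E - r B)"
      using upowi_add[OF units(1), of "r E - r A" "r A - r B"]
      by (simp add: upowi_uminus[OF units(1)] ac_simps)
    have "int (card D) - r D = int (card A) - r A + ?j" by simp
    then have d: "d upowi (int (card A) - r A) * (- d) upowi ?j =
        (-1) upowi ?j * d upowi (int (card D) - r D)"
      by (simp only: upowi_uminus[OF units(4)] upowi_add[OF units(4)] ac_simps)
    have "(-1 :: (indet, 'r) laurent) upowi (r A - r B) * (-1) upowi ?j =
        (-1) upowi (r A - r B + ?j)"
      by (rule upowi_add[symmetric]) simp
    \<comment> \<open>The exponents differ by \<open>2 * (r A - int (card A))\<close>, so the rank
      of \<open>A\<close> leaves the sign.\<close>
    also have "\<dots> = (-1) upowi (int (card D) - r B - r D + int (card A))"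
      by (rule minus_one_upowi_cong) simp
    also have "\<dots> = (-1) upowi (int (card D) - r B - r D) * (-1) ^ card A"
      by (simp add: upowi_add[of _ _ "int (card A)"])
    finally have sign: "(-1 :: (indet, 'r) laurent) upowi (r A - r B) * (-1) upowi ?j =
      (-1) upowi (int (card D) - r B - r D) * (-1) ^ card A" .
    have "a upowi (r E - r A) * d upowi (int (card A) - r A)
        * (laurent_const (m1 B) * (- a) upowi (r A - r B) * (- c) upowi (int (card B) - r B))
        * (laurent_const (m2 D) * (- b) upowi (r E - r D) * (- d) upowi ?j) =
      laurent_const (m1 B * m2 D) * (a upowi (r E - r A) * (- a) upowi (r A - r B))
        * (- b) upowi (r E - r D) * (- c) upowi (int (card B) - r B)
        * (d upowi (int (card A) - r A) * (- d) upowi ?j)"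
      by (simp only: laurent_const_mult ac_simps)
    also have "\<dots> = laurent_const (m1 B * m2 D) * a upowi (r E - r B)
        * (- b) upowi (r E - r D) * (- c) upowi (int (card B) - r B)
        * d upowi (int (card D) - r D) * ((-1) upowi (r A - r B) * (-1) upowi ?j)"
      by (simp only: a d mult_ac)
    also have "\<dots> = F B D * (-1) ^ card A"
      by (simp only: sign F_def mult_ac)
    finally show ?thesis .
  qed
  have diagonal: "F D D * (-1) ^ card D = laurent_const (m1 D * m2 D)
      * (- (a * b)) upowi (r E - r D) * (- (c * d)) upowi (int (card D) - r D)" for D
  proof -
    have "(-1 :: (indet, 'r) laurent) upowi (int (card D) - r D - r D) * (-1) ^ card D =
        (-1) upowi (int (card D) - r D - r D + int (card D))"
      by (subst upowi_add[of _ _ "int (card D)"]) simp_all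
    \<comment> \<open>The exponent is \<open>2 * (int (card D) - r D)\<close>.\<close>
    also have "\<dots> = (-1) upowi 0"
      by (rule minus_one_upowi_cong) simp
    finally have sign: "(-1 :: (indet, 'r) laurent) upowi (int (card D) - r D - r D)
      * (-1) ^ card D = 1" by simp
    have "(- (a * b)) upowi k = a upowi k * (- b) upowi k" for k
      using upowi_mult_distrib[of a "- b" k] units by simp
    moreover have "(- (c * d)) upowi k = (- c) upowi k * d upowi k" for k
      using upowi_mult_distrib[of "- c" d k] units by simp
    ultimately show ?thesis
      by (simp only: F_def sign mult.assoc mult_1_right)
  qed
  have "(\<Sum>A\<in>Pow E.
       a upowi (r E - r A) * d upowi (int (card A) - r A)
       * tutte_eval (rsm_restrict (rsm E r m1) A) (1 - a) (1 - c)
       * tutte_eval (rsm_contract (rsm E r m2) A) (1 - b) (1 - d)) =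
    (\<Sum>A\<in>Pow E. \<Sum>B\<in>Pow A. \<Sum>D\<in>{A..E}. F B D * (-1) ^ card A)"
    \<comment> \<open>The product of the two evaluations is expanded into a double sum; the final
      \<open>sum.swap\<close> puts its inner sums into the order of the chain.\<close>
    by (intro sum.cong refl)
      (simp add: tutte_eval_restrict tutte_eval_contract \<open>finite E\<close> sum_distrib_left
        sum_distrib_right mult.assoc flip: telescope, rule sum.swap)
  also have "\<dots> = (\<Sum>B\<in>Pow E. \<Sum>D\<in>Pow E. F B D * (\<Sum>A\<in>{B..D}. (-1) ^ card A))"
    by (simp add: sum_Pow_chains \<open>finite E\<close> sum_distrib_left)
  \<comment> \<open>The alternating sum over the interval leaves only the chains that collapse to a
    single set.\<close>
  also have "\<dots> = (\<Sum>B\<in>Pow E. \<Sum>D\<in>Pow E. if B = D then F B D * (-1) ^ card D else 0)"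
    by (intro sum.cong refl)
      (use \<open>finite E\<close> in \<open>auto simp: sum_minus_one_card_interval finite_subset\<close>)
  also have "\<dots> = (\<Sum>D\<in>Pow E. F D D * (-1) ^ card D)"
    using \<open>finite E\<close> by (simp add: sum.delta')
  also have "\<dots> = tutte_eval (rsm E r (\<lambda>A. m1 A * m2 A)) (1 - a * b) (1 - c * d)"
    by (simp add: diagonal tutte_eval_eq_sum rsm_def)
  finally show ?thesis ..
qed

end
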